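(* Let $d\ge1$. If $\kappa_d$ is algebraic and $E_d\neq\emptyset$, then $\gcd(E_d)>1$, i.e. some fixed prime divides every element of $E_d$.
   Context: For integers $d,n\ge1$, $T_d(n)$ is the Cayley graph of $(\mathbb{Z}/n\mathbb{Z})^d$ with respect to $\{\pm e_1,\dots,\pm e_d\}\setminus\{0\}$ ($e_i$ the standard basis vectors); it is a simple graph, and $T_d(1)$ is a single vertex with no edges. $a_d(n)$ is the number of independent sets of $T_d(n)$ (including the empty set), so $a_d(1)=2$. The limit $\kappa_d=\lim_{n\to\infty}a_d(n)^{1/n^d}$ exists and is a positive real number. $E_d=\{n\ge1: a_d(n)=\kappa_d^{n^d}\}$. *)

theory Defs
  imports "HOL-Analysis.Analysis" "HOL-Algebra.Product_Groups"
    "HOL-Computational_Algebra.Computational_Algebra"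
begin

definition cayley_edges :: "('a, 'b) monoid_scheme \<Rightarrow> 'a set \<Rightarrow> 'a set set" where
  "cayley_edges G S = {{x, x \<otimes>\<^bsub>G\<^esub> s} | x s. x \<in> carrier G \<and> s \<in> S}"

definition independent_sets :: "'a set \<Rightarrow> 'a set set \<Rightarrow> 'a set set" where
  "independent_sets V E = {I. I \<subseteq> V \<and> (\<forall>x\<in>I. \<forall>y\<in>I. {x, y} \<notin> E)}"

(* integer_mod_group n has carrier {0..<int n} for n \<ge> 1 (and is the infinite cyclic group for
   n = 0); elements of the product are extensional functions on {..<d}. *)
definition torus_group :: "nat \<Rightarrow> nat \<Rightarrow> (nat \<Rightarrow> int) monoid" where
  "torus_group d n = product_group {..<d} (\<lambda>_. integer_mod_group n)"

(* "1 mod int n" rather than 1, so that e_i is the identity element when n = 1. *)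
definition torus_basis :: "nat \<Rightarrow> nat \<Rightarrow> nat \<Rightarrow> (nat \<Rightarrow> int)" where
  "torus_basis d n i = (\<lambda>j\<in>{..<d}. if j = i then 1 mod int n else 0)"

definition torus_connection_set :: "nat \<Rightarrow> nat \<Rightarrow> (nat \<Rightarrow> int) set" where
  "torus_connection_set d n =
     ((\<Union>i<d. {torus_basis d n i, inv\<^bsub>torus_group d n\<^esub> (torus_basis d n i)})
        - {\<one>\<^bsub>torus_group d n\<^esub>})"

definition torus_vertices :: "nat \<Rightarrow> nat \<Rightarrow> (nat \<Rightarrow> int) set" where
  "torus_vertices d n = carrier (torus_group d n)"

definition torus_edges :: "nat \<Rightarrow> nat \<Rightarrow> (nat \<Rightarrow> int) set set" where
  "torus_edges d n = cayley_edges (torus_group d n) (torus_connection_set d n)"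

definition indep_count :: "nat \<Rightarrow> nat \<Rightarrow> nat" where
  "indep_count d n = card (independent_sets (torus_vertices d n) (torus_edges d n))"

definition kappa :: "nat \<Rightarrow> real" where
  "kappa d = lim (\<lambda>n. real (indep_count d n) powr (1 / real (n ^ d)))"

definition exact_set :: "nat \<Rightarrow> nat set" where
  "exact_set d = {n. n \<ge> 1 \<and> real (indep_count d n) = kappa d ^ (n ^ d)}"

end

theory Submission
  imports Defs
begin

text \<open>If no prime divides every element of \<open>E\<^sub>d\<close>, then the least \<open>k > 0\<close> with \<open>\<kappa>\<^sub>d ^ k\<close> rational
  is \<open>1\<close>, because it divides \<open>n ^ d\<close> for every \<open>n\<close> in \<open>E\<^sub>d\<close>. So \<open>\<kappa>\<^sub>d\<close> is rational, and having an
  integer power it is an integer. This contradicts \<open>1 < \<kappa>\<^sub>d < 2\<close>, where the lower bound comes from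
  \<open>2 \<le> a\<^sub>d(n) = \<kappa>\<^sub>d ^ (n ^ d)\<close>. For the upper bound, and for the existence of the limit, compare
  \<open>a\<^sub>d(n)\<close> with the number \<open>b\<^sub>d(m)\<close> of independent sets of the \<open>d\<close>-dimensional grid of side \<open>m\<close>:
  \<open>b\<^sub>d(m) \<le> a\<^sub>d(m + 1)\<close>, and cutting the torus into grid blocks of side \<open>m\<close> bounds
  \<open>a\<^sub>d(n)\<close> by \<open>b\<^sub>d(m)\<close> to the power of the number of blocks, times \<open>2\<close> to the number of
  vertices left over.\<close>

section \<open>Boxes and grids without wraparound\<close>

definition box :: "nat \<Rightarrow> nat \<Rightarrow> (nat \<Rightarrow> int) set" where
  "box d n = {..<d} \<rightarrow>\<^sub>E {0..<int n}"

text \<open>Each grid edge is tested once, from its lower endpoint. There is no reduction modulo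
  \<open>n\<close>, so the notion does not depend on the side of the box.\<close>

definition grid_independent :: "nat \<Rightarrow> (nat \<Rightarrow> int) set \<Rightarrow> bool" where
  "grid_independent d I \<longleftrightarrow> (\<forall>x\<in>I. \<forall>i<d. x(i := x i + 1) \<notin> I)"

definition grid_count :: "nat \<Rightarrow> nat \<Rightarrow> nat" where
  "grid_count d n = card {I. I \<subseteq> box d n \<and> grid_independent d I}"

lemma finite_box [simp]: "finite (box d n)"
  by (simp add: box_def finite_PiE)

lemma card_box [simp]: "card (box d n) = n ^ d"
  by (simp add: box_def card_funcsetE)

lemma box_mono: "m \<le> n \<Longrightarrow> box d m \<subseteq> box d n"
  unfolding box_def by (rule PiE_mono) auto

section \<open>The torus graph in coordinates\<close>

lemma torus_vertices_eq: "n \<ge> 1 \<Longrightarrow> torus_vertices d n = box d n"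
  by (simp add: torus_vertices_def torus_group_def box_def carrier_integer_mod_group)

lemma group_torus_group: "group (torus_group d n)"
  by (simp add: torus_group_def)

lemma torus_basis_closed: "n \<ge> 1 \<Longrightarrow> torus_basis d n i \<in> carrier (torus_group d n)"
  by (auto simp: torus_basis_def torus_group_def carrier_integer_mod_group)

lemma torus_mult_basis:
  assumes "n \<ge> 1" "x \<in> box d n" "i < d"
  shows "x \<otimes>\<^bsub>torus_group d n\<^esub> torus_basis d n i = x(i := (x i + 1) mod int n)"
proof
  fix j
  show "(x \<otimes>\<^bsub>torus_group d n\<^esub> torus_basis d n i) j = (x(i := (x i + 1) mod int n)) j"
    using assms by (cases "j < d")
      (auto simp: torus_group_def torus_basis_def box_def PiE_iff extensional_def mod_simps)
qed

lemma torus_basis_neq_one: "n \<ge> 2 \<Longrightarrow> i < d \<Longrightarrow> torus_basis d n i \<noteq> \<one>\<^bsub>torus_group d n\<^esub>"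
  by (auto simp: torus_group_def torus_basis_def fun_eq_iff)

lemma cayley_edges_memI:
  "x \<in> carrier G \<Longrightarrow> s \<in> S \<Longrightarrow> {x, x \<otimes>\<^bsub>G\<^esub> s} \<in> cayley_edges G S"
  by (auto simp: cayley_edges_def)

text \<open>An edge along an inverse generator is the edge along the generator itself, read from its
  other endpoint. With \<open>n \<ge> 2\<close> no basis vector is the identity, so removing the
  identity loses no direction.\<close>

lemma torus_edges_eq:
  assumes "n \<ge> 2"
  shows "torus_edges d n = {{x, x(i := (x i + 1) mod int n)} | x i. x \<in> box d n \<and> i < d}"
    (is "_ = ?R")
proof (intro equalityI subsetI)
  interpret G: group "torus_group d n" by (rule group_torus_group)
  have carrier: "carrier (torus_group d n) = box d n"
    using assms torus_vertices_eq[of n d] by (simp add: torus_vertices_def)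
  fix e assume "e \<in> torus_edges d n"
  then obtain x s where e: "e = {x, x \<otimes>\<^bsub>torus_group d n\<^esub> s}" and x: "x \<in> box d n"
    and s: "s \<in> torus_connection_set d n"
    by (auto simp: torus_edges_def cayley_edges_def carrier)
  from s obtain i where i: "i < d" and
    "s = torus_basis d n i \<or> s = inv\<^bsub>torus_group d n\<^esub> (torus_basis d n i)"
    by (auto simp: torus_connection_set_def)
  then consider "s = torus_basis d n i" | "s = inv\<^bsub>torus_group d n\<^esub> (torus_basis d n i)" by blast
  then show "e \<in> ?R"
  proof cases
    case 1
    then show ?thesis using e x i torus_mult_basis[of n x d i] assms by auto
  next
    case 2
    \<comment> \<open>\<open>y\<close> is the other endpoint; the positive step leads from it back
      to \<open>x\<close>.\<close>
    define y where "y = x \<otimes>\<^bsub>torus_group d n\<^esub> s"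
    have b: "torus_basis d n i \<in> carrier (torus_group d n)"
      using assms by (intro torus_basis_closed) auto
    have y: "y \<in> box d n"
      using x b 2 unfolding y_def carrier[symmetric] by simp
    have "y \<otimes>\<^bsub>torus_group d n\<^esub> torus_basis d n i = x"
      using x b 2 unfolding y_def carrier[symmetric] by (simp add: G.m_assoc)
    then have "e = {y, y(i := (y i + 1) mod int n)}"
      using e torus_mult_basis[of n y d i] y i assms unfolding y_def[symmetric] by auto
    then show ?thesis using y i by blast
  qed
next
  have carrier: "carrier (torus_group d n) = box d n"
    using assms torus_vertices_eq[of n d] by (simp add: torus_vertices_def)
  fix e assume "e \<in> ?R"
  then obtain x i where x: "x \<in> box d n" and i: "i < d"
    and e: "e = {x, x(i := (x i + 1) mod int n)}"
    by blast
  have "torus_basis d n i \<in> torus_connection_set d n"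
    using i torus_basis_neq_one[OF assms i] by (auto simp: torus_connection_set_def)
  then have "{x, x \<otimes>\<^bsub>torus_group d n\<^esub> torus_basis d n i} \<in> torus_edges d n"
    unfolding torus_edges_def using x carrier by (intro cayley_edges_memI) auto
  then show "e \<in> torus_edges d n"
    using e torus_mult_basis[of n x d i] x i assms by auto
qed

text \<open>\<open>independent_sets\<close> also tests pairs with \<open>x = y\<close>, so
  one-element sets are independent only because there are no loops.\<close>

lemma (in group) singleton_notin_cayley_edges:
  assumes "S \<subseteq> carrier G - {\<one>}"
  shows "{v} \<notin> cayley_edges G S"
proof
  assume "{v} \<in> cayley_edges G S"
  then obtain s where "v \<in> carrier G" "s \<in> S" "v \<otimes> s = v"
    by (auto simp: cayley_edges_def set_eq_iff) metis
  then show False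
    using assms r_cancel_one[of v s] by auto
qed

lemma singleton_notin_torus_edges:
  assumes "n \<ge> 1"
  shows "{v} \<notin> torus_edges d n"
proof -
  interpret G: group "torus_group d n" by (rule group_torus_group)
  have "torus_connection_set d n \<subseteq> carrier (torus_group d n) - {\<one>\<^bsub>torus_group d n\<^esub>}"
    using torus_basis_closed[OF assms, of d] by (auto simp: torus_connection_set_def)
  then show ?thesis
    unfolding torus_edges_def by (rule G.singleton_notin_cayley_edges)
qed

lemma finite_independent_sets: "finite V \<Longrightarrow> finite (independent_sets V E)"
  by (rule finite_subset[of _ "Pow V"]) (auto simp: independent_sets_def)

lemma indep_count_ge_2:
  assumes "n \<ge> 1"
  shows "indep_count d n \<ge> 2"
proof -
  have "box d n \<noteq> {}"
    using assms by (auto simp: box_def PiE_eq_empty_iff)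
  then obtain v where "v \<in> box d n" by blast
  then have "{{}, {v}} \<subseteq> independent_sets (torus_vertices d n) (torus_edges d n)"
    using assms singleton_notin_torus_edges[of n v d]
    by (auto simp: independent_sets_def torus_vertices_eq)
  then have "card {{}, {v}} \<le> indep_count d n"
    unfolding indep_count_def using assms
    by (intro card_mono finite_independent_sets) (simp_all add: torus_vertices_eq)
  then show ?thesis by simp
qed

section \<open>Grid counts compared with torus counts\<close>

lemma finite_grid_independent_sets: "finite {I. I \<subseteq> box d n \<and> grid_independent d I}"
  by (rule finite_subset[of _ "Pow (box d n)"]) auto

lemma grid_count_pos: "grid_count d n > 0"
proof -
  have "{} \<in> {I. I \<subseteq> box d n \<and> grid_independent d I}"
    by (simp add: grid_independent_def)
  then show ?thesis
    unfolding grid_count_def using finite_grid_independent_sets card_gt_0_iff by blast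
qed

lemma grid_count_le: "grid_count d n \<le> 2 ^ (n ^ d)"
proof -
  have "grid_count d n \<le> card (Pow (box d n))"
    unfolding grid_count_def by (rule card_mono) auto
  then show ?thesis by (simp add: card_Pow)
qed

text \<open>The origin and its neighbour in direction 0 both lie in the box, so the full box is not
  independent. This strictness is the source of the bound \<open>kappa d < 2\<close>.\<close>

lemma grid_count_2_less:
  assumes "d \<ge> 1"
  shows "grid_count d 2 < 2 ^ (2 ^ d)"
proof -
  have "\<not> grid_independent d (box d 2)"
  proof
    assume *: "grid_independent d (box d 2)"
    have "(\<lambda>j\<in>{..<d}. 0) \<in> box d 2" "(\<lambda>j\<in>{..<d}. 0)(0 := (\<lambda>j\<in>{..<d}. 0) 0 + 1) \<in> box d 2"
      using assms by (auto simp: box_def PiE_iff extensional_def)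
    then show False using * assms unfolding grid_independent_def by force
  qed
  then have "{I. I \<subseteq> box d 2 \<and> grid_independent d I} \<subset> Pow (box d 2)" by blast
  then have "grid_count d 2 < card (Pow (box d 2))"
    unfolding grid_count_def by (intro psubset_card_mono) auto
  then show ?thesis by (simp add: card_Pow)
qed

text \<open>Every grid edge is also a torus edge, so independence in the torus is the stronger
  condition.\<close>

lemma indep_count_le_grid_count:
  assumes "n \<ge> 2"
  shows "indep_count d n \<le> grid_count d n"
  unfolding indep_count_def grid_count_def
proof (rule card_mono[OF finite_grid_independent_sets], rule subsetI)
  fix I assume I: "I \<in> independent_sets (torus_vertices d n) (torus_edges d n)"
  have sub: "I \<subseteq> box d n"
    using I assms by (auto simp: independent_sets_def torus_vertices_eq)
  have "x(i := x i + 1) \<notin> I" if "x \<in> I" "i < d" for x i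
  proof
    assume y: "x(i := x i + 1) \<in> I"
    have "x(i := x i + 1) \<in> box d n" "x \<in> box d n" using y that sub by auto
    then have "x i \<in> {0..<int n}" "(x(i := x i + 1)) i \<in> {0..<int n}"
      using \<open>i < d\<close> unfolding box_def by (blast intro: PiE_mem)+
    then have upd: "x(i := (x i + 1) mod int n) = x(i := x i + 1)" by simp
    have "{x, x(i := (x i + 1) mod int n)} \<in> torus_edges d n"
      unfolding torus_edges_eq[OF assms] using \<open>x \<in> box d n\<close> \<open>i < d\<close> by blast
    then have "{x, x(i := x i + 1)} \<in> torus_edges d n" unfolding upd .
    then show False using I y \<open>x \<in> I\<close> by (auto simp: independent_sets_def)
  qed
  then show "I \<in> {I. I \<subseteq> box d n \<and> grid_independent d I}"
    using sub by (simp add: grid_independent_def)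
qed

text \<open>In the torus of side \<open>Suc m\<close> the coordinate value \<open>m\<close> is left
  free. A wraparound edge has an endpoint with that value, so it cannot join two points of the
  smaller box.\<close>

lemma grid_count_le_indep_count:
  assumes "m \<ge> 1"
  shows "grid_count d m \<le> indep_count d (Suc m)"
  unfolding indep_count_def grid_count_def
proof (rule card_mono)
  show "finite (independent_sets (torus_vertices d (Suc m)) (torus_edges d (Suc m)))"
    by (intro finite_independent_sets) (simp add: torus_vertices_eq)
  show "{I. I \<subseteq> box d m \<and> grid_independent d I}
    \<subseteq> independent_sets (torus_vertices d (Suc m)) (torus_edges d (Suc m))"
  proof safe
    fix I assume sub: "I \<subseteq> box d m" and ind: "grid_independent d I"
    have "{x, y} \<notin> torus_edges d (Suc m)" if "x \<in> I" "y \<in> I" for x y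
    proof
      assume "{x, y} \<in> torus_edges d (Suc m)"
      then obtain z i where "{x, y} = {z, z(i := (z i + 1) mod int (Suc m))}" and i: "i < d"
        using torus_edges_eq[of "Suc m" d] assms by auto
      then have z: "z \<in> I" "z(i := (z i + 1) mod int (Suc m)) \<in> I"
        using that by (auto simp: doubleton_eq_iff)
      have "z i \<in> {0..<int m}" using z(1) sub i by (auto simp: box_def PiE_iff)
      then have "(z i + 1) mod int (Suc m) = z i + 1" by simp
      then show False using z i ind unfolding grid_independent_def by metis
    qed
    moreover have "I \<subseteq> torus_vertices d (Suc m)"
      using sub box_mono[of m "Suc m" d] by (auto simp: torus_vertices_eq)
    ultimately show "I \<in> independent_sets (torus_vertices d (Suc m)) (torus_edges d (Suc m))"
      by (simp add: independent_sets_def)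
  qed
qed

section \<open>Cutting a box into blocks\<close>

text \<open>\<open>c\<close> selects the block of side \<open>m\<close> and \<open>x\<close> is the
  offset inside it; the restriction to \<open>{..<d}\<close> keeps the result extensional.\<close>

definition block_point :: "nat \<Rightarrow> nat \<Rightarrow> (nat \<Rightarrow> int) \<Rightarrow> (nat \<Rightarrow> int) \<Rightarrow> nat \<Rightarrow> int" where
  "block_point d m c x = (\<lambda>j\<in>{..<d}. int m * c j + x j)"

lemma block_point_upd:
  "i < d \<Longrightarrow> block_point d m c (x(i := x i + 1)) = (block_point d m c x)(i := block_point d m c x i + 1)"
  by (auto simp: block_point_def fun_eq_iff)

lemma box_mult_cases:
  assumes "m \<ge> 1" "y \<in> box d (q * m)"
  obtains c x where "c \<in> box d q" "x \<in> box d m" "y = block_point d m c x"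
proof
  have y: "0 \<le> y j" "y j < int q * int m" if "j < d" for j
    using assms that by (auto simp: box_def PiE_iff)
  have "y j div int m < int q" if "j < d" for j
  proof (rule ccontr)
    assume "\<not> ?thesis"
    then have "int q * int m \<le> y j div int m * int m" by (intro mult_right_mono) auto
    also have "\<dots> \<le> y j"
      using div_mult_mod_eq[of "y j" "int m"] pos_mod_sign[of "int m" "y j"] assms(1) by linarith
    finally show False using y(2)[OF that] by simp
  qed
  then show "(\<lambda>j\<in>{..<d}. y j div int m) \<in> box d q"
    using y assms(1) by (auto simp: box_def pos_imp_zdiv_nonneg_iff)
  show "(\<lambda>j\<in>{..<d}. y j mod int m) \<in> box d m"
    using assms(1) by (auto simp: box_def)
  show "y = block_point d m (\<lambda>j\<in>{..<d}. y j div int m) (\<lambda>j\<in>{..<d}. y j mod int m)"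
    using assms(2) by (auto simp: block_point_def box_def PiE_iff extensional_def fun_eq_iff)
qed

text \<open>An independent set is determined by its traces on the \<open>q ^ d\<close> blocks and on
  the leftover region. Each trace on a block is a translate of an independent set of the small grid;
  on the leftover region any subset is allowed for.\<close>

lemma grid_count_block_le:
  assumes "m \<ge> 1" "q * m \<le> n"
  shows "grid_count d n \<le> grid_count d m ^ (q ^ d) * 2 ^ (n ^ d - (q * m) ^ d)"
proof -
  define F where "F = {I. I \<subseteq> box d m \<and> grid_independent d I}"
  define R where "R = box d n - box d (q * m)"
  define \<phi> where "\<phi> I = (\<lambda>c\<in>box d q. {x \<in> box d m. block_point d m c x \<in> I}, I \<inter> R)" for I
  have "inj_on \<phi> {I. I \<subseteq> box d n \<and> grid_independent d I}"
  proof (rule inj_onI)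
    fix I J
    assume I: "I \<in> {I. I \<subseteq> box d n \<and> grid_independent d I}"
      and J: "J \<in> {I. I \<subseteq> box d n \<and> grid_independent d I}" and eq: "\<phi> I = \<phi> J"
    have R: "I \<inter> R = J \<inter> R" using eq by (simp add: \<phi>_def)
    have blk: "block_point d m c x \<in> I \<longleftrightarrow> block_point d m c x \<in> J"
      if "c \<in> box d q" "x \<in> box d m" for c x
    proof -
      have "fst (\<phi> I) c = fst (\<phi> J) c" using eq by simp
      then show ?thesis using that by (auto simp: \<phi>_def)
    qed
    have "y \<in> I \<longleftrightarrow> y \<in> J" if "y \<in> box d n" for y
    proof (cases "y \<in> box d (q * m)")
      case True
      then show ?thesis using box_mult_cases[OF assms(1) True] blk by metis
    next
      case False
      then show ?thesis using that R by (auto simp: R_def)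
    qed
    then show "I = J" using I J by blast
  qed
  \<comment> \<open>Translation into a block commutes with a unit step, so each trace stays
    independent.\<close>
  moreover have "\<phi> ` {I. I \<subseteq> box d n \<and> grid_independent d I} \<subseteq> (box d q \<rightarrow>\<^sub>E F) \<times> Pow R"
    by (auto simp: \<phi>_def F_def grid_independent_def block_point_upd)
  moreover have finF: "finite F" unfolding F_def by (rule finite_grid_independent_sets)
  moreover have finR: "finite R" by (simp add: R_def)
  ultimately have "grid_count d n \<le> card ((box d q \<rightarrow>\<^sub>E F) \<times> Pow R)"
    unfolding grid_count_def by (intro card_inj_on_le) (auto simp: finite_PiE)
  also have "\<dots> = card F ^ (q ^ d) * 2 ^ card R"
    using finR by (simp add: card_cartesian_product card_funcsetE card_Pow)
  also have "card R = n ^ d - (q * m) ^ d"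
    unfolding R_def using box_mono[OF assms(2), of d] by (simp add: card_Diff_subset)
  finally show ?thesis by (simp add: F_def grid_count_def)
qed

section \<open>Convergence of the normalised logarithms\<close>

lemma tendsto_floor_multiple:
  assumes "m \<ge> 1"
  shows "(\<lambda>n. real (n div m * m) / real n) \<longlonglongrightarrow> 1"
proof (rule tendsto_sandwich)
  show "\<forall>\<^sub>F n in sequentially. 1 - real m / real n \<le> real (n div m * m) / real n"
    using eventually_gt_at_top[of 0]
  proof eventually_elim
    case (elim n)
    have "n \<le> n div m * m + m"
      using div_mult_mod_eq[of n m] mod_less_divisor[of m n] assms by linarith
    then have "real n - real m \<le> real (n div m * m)" by linarith
    then have "(real n - real m) / real n \<le> real (n div m * m) / real n"
      by (intro divide_right_mono) auto
    then show ?case using elim by (simp add: diff_divide_distrib)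
  qed
  show "\<forall>\<^sub>F n in sequentially. real (n div m * m) / real n \<le> 1"
  proof (intro always_eventually allI)
    fix n
    have "real (n div m * m) \<le> real n" by (rule of_nat_mono) simp
    then show "real (n div m * m) / real n \<le> 1" by (auto simp: divide_le_eq_1)
  qed
  show "(\<lambda>n. 1 - real m / real n) \<longlonglongrightarrow> 1"
    using tendsto_diff[OF tendsto_const lim_const_over_n[of "real m"], of 1] by simp
qed simp

text \<open>A variant of Fekete's subadditivity argument: the limit is the infimum of
  \<open>ln (b\<^sub>d(m)) / m ^ d\<close>.\<close>

lemma indep_count_limit:
  assumes "d \<ge> 1"
  obtains L where "L < ln 2" "(\<lambda>n. ln (real (indep_count d n)) / real (n ^ d)) \<longlonglongrightarrow> L"
proof -
  define x where "x n = ln (real (indep_count d n)) / real (n ^ d)" for n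
  define \<beta> where "\<beta> m = ln (real (grid_count d m)) / real (m ^ d)" for m
  define L where "L = (INF m\<in>{1..}. \<beta> m)"
  have pos: "real (grid_count d m) \<ge> 1" for m
    using grid_count_pos[of d m] by linarith
  have \<beta>_nonneg: "\<beta> m \<ge> 0" for m
    unfolding \<beta>_def using pos[of m] by (intro divide_nonneg_nonneg) auto
  have bdd: "bdd_below (\<beta> ` {1..})"
    by (rule bdd_belowI[of _ 0]) (auto simp: \<beta>_nonneg)
  have L_le: "L \<le> \<beta> m" if "m \<ge> 1" for m
    unfolding L_def using that by (intro cINF_lower[OF bdd]) auto
  \<comment> \<open>Side 1 would only give \<open>\<beta> 1 = ln 2\<close>; side 2 is the first with
    an edge.\<close>
  have "\<beta> 2 < ln 2"
  proof -
    have "real (grid_count d 2) < 2 ^ (2 ^ d)"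
      using grid_count_2_less[OF assms] by (metis of_nat_less_iff of_nat_numeral of_nat_power)
    then have "ln (real (grid_count d 2)) < ln (2 ^ (2 ^ d))"
      using pos[of 2] by (subst ln_less_cancel_iff) auto
    then show ?thesis by (simp add: \<beta>_def ln_realpow divide_less_eq mult.commute)
  qed
  with L_le[of 2] have "L < ln 2" by simp
  \<comment> \<open>The factor converts from the \<open>(n - 1) ^ d\<close> vertices of the grid to
    the \<open>n ^ d\<close> vertices of the torus.\<close>
  have lower: "L * (1 - 1 / real n) ^ d \<le> x n" if n: "n \<ge> 2" for n
  proof -
    define m where "m = n - 1"
    have m: "m \<ge> 1" "n = Suc m" using n by (auto simp: m_def)
    have "1 - 1 / real n = real m / real n" using m by (simp add: field_simps)
    then have "L * (1 - 1 / real n) ^ d = L * (real m / real n) ^ d" by (rule arg_cong)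
    also have "\<dots> \<le> \<beta> m * (real m / real n) ^ d"
      using L_le[OF m(1)] by (intro mult_right_mono) auto
    also have "\<beta> m * (real m / real n) ^ d = ln (real (grid_count d m)) / real (n ^ d)"
      using m by (simp add: \<beta>_def power_divide)
    also have "\<dots> \<le> x n"
      unfolding x_def using grid_count_le_indep_count[OF m(1), of d] pos[of m] m(2)
      by (intro divide_right_mono) auto
    finally show ?thesis .
  qed
  \<comment> \<open>A weighted mean: the fraction of vertices covered by blocks has weight
    \<open>\<beta> m\<close>, the rest has the trivial rate \<open>ln 2\<close>.\<close>
  have upper: "x n \<le> \<beta> m * (real (n div m * m) / real n) ^ d
      + ln 2 * (1 - (real (n div m * m) / real n) ^ d)" if m: "m \<ge> 1" and n: "n \<ge> 2" for m n
  proof -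
    define q where "q = n div m"
    have qm: "q * m \<le> n" by (simp add: q_def)
    have "indep_count d n \<le> grid_count d m ^ (q ^ d) * 2 ^ (n ^ d - (q * m) ^ d)"
      using indep_count_le_grid_count[OF n, of d] grid_count_block_le[OF m qm, of d] by linarith
    then have "real (indep_count d n) \<le> real (grid_count d m ^ (q ^ d) * 2 ^ (n ^ d - (q * m) ^ d))"
      by (simp only: of_nat_le_iff)
    then have "ln (real (indep_count d n))
        \<le> ln (real (grid_count d m ^ (q ^ d) * 2 ^ (n ^ d - (q * m) ^ d)))"
      using indep_count_ge_2[of n d] n by (subst ln_le_cancel_iff) (auto simp: grid_count_pos)
    also have "\<dots> = real (q ^ d) * ln (real (grid_count d m)) + real (n ^ d - (q * m) ^ d) * ln 2"
      using grid_count_pos[of d m] by (simp add: ln_mult ln_realpow)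
    also have "real (n ^ d - (q * m) ^ d) = real n ^ d - real (q * m) ^ d"
      using qm by (simp add: of_nat_diff power_mono del: of_nat_mult)
    also have "real (q ^ d) * ln (real (grid_count d m)) = \<beta> m * real (q * m) ^ d"
      using m by (simp add: \<beta>_def power_mult_distrib)
    finally have "x n \<le> (\<beta> m * real (q * m) ^ d + (real n ^ d - real (q * m) ^ d) * ln 2) / real (n ^ d)"
      unfolding x_def by (intro divide_right_mono) auto
    also have "\<dots> = \<beta> m * (real (q * m) / real n) ^ d + ln 2 * (1 - (real (q * m) / real n) ^ d)"
      using n by (simp add: power_divide field_simps del: of_nat_mult)
    finally show ?thesis by (simp add: q_def)
  qed
  have "x \<longlonglongrightarrow> L"
  proof (rule order_tendstoI)
    fix a assume "a < L"
    have "(\<lambda>n. L * (1 - 1 / real n) ^ d) \<longlonglongrightarrow> L * (1 - 0) ^ d"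
      by (intro tendsto_intros lim_const_over_n)
    then have "\<forall>\<^sub>F n in sequentially. a < L * (1 - 1 / real n) ^ d"
      using \<open>a < L\<close> by (intro order_tendstoD(1)[of _ L]) auto
    then show "\<forall>\<^sub>F n in sequentially. a < x n"
      using eventually_ge_at_top[of 2] by eventually_elim (use lower in force)
  next
    fix a assume "L < a"
    then obtain m where m: "m \<ge> 1" "\<beta> m < a"
      unfolding L_def using cINF_less_iff[of "{1..}" \<beta> a] bdd by auto
    \<comment> \<open>With \<open>m\<close> fixed, the covered fraction tends to 1 and only
      \<open>\<beta> m\<close> survives.\<close>
    have "(\<lambda>n. \<beta> m * (real (n div m * m) / real n) ^ d
        + ln 2 * (1 - (real (n div m * m) / real n) ^ d)) \<longlonglongrightarrow> \<beta> m * 1 ^ d + ln 2 * (1 - 1 ^ d)"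
      by (intro tendsto_intros tendsto_floor_multiple m)
    then have "\<forall>\<^sub>F n in sequentially. \<beta> m * (real (n div m * m) / real n) ^ d
        + ln 2 * (1 - (real (n div m * m) / real n) ^ d) < a"
      using m by (intro order_tendstoD(2)[of _ "\<beta> m"]) auto
    then show "\<forall>\<^sub>F n in sequentially. x n < a"
      using eventually_ge_at_top[of 2] by eventually_elim (use upper[OF m(1)] in force)
  qed
  with \<open>L < ln 2\<close> show ?thesis using that unfolding x_def by blast
qed

text \<open>\<open>kappa\<close> is given by \<open>lim\<close>, so it has a known value only once
  convergence is established; it is then \<open>exp L\<close> with \<open>L < ln 2\<close>.\<close>

lemma kappa_bounds:
  assumes "d \<ge> 1"
  shows "kappa d > 0" "kappa d < 2"
proof -
  obtain L where L: "L < ln 2" "(\<lambda>n. ln (real (indep_count d n)) / real (n ^ d)) \<longlonglongrightarrow> L"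
    using indep_count_limit[OF assms] .
  have "(\<lambda>n. exp (ln (real (indep_count d n)) / real (n ^ d))) \<longlonglongrightarrow> exp L"
    by (intro tendsto_exp L)
  moreover have "\<forall>\<^sub>F n in sequentially. exp (ln (real (indep_count d n)) / real (n ^ d))
      = real (indep_count d n) powr (1 / real (n ^ d))"
    using eventually_ge_at_top[of 1]
  proof eventually_elim
    case (elim n)
    then show ?case using indep_count_ge_2[of n d] by (simp add: powr_def)
  qed
  ultimately have "(\<lambda>n. real (indep_count d n) powr (1 / real (n ^ d))) \<longlonglongrightarrow> exp L"
    by (rule Lim_transform_eventually)
  then have "kappa d = exp L" unfolding kappa_def by (rule limI)
  moreover have "exp L < exp (ln 2)" using L(1) by (subst exp_less_cancel_iff)
  ultimately show "kappa d > 0" "kappa d < 2" by auto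
qed

section \<open>Rational powers and the common prime divisor\<close>

text \<open>Division with remainder: if \<open>x ^ n\<close> and \<open>x ^ k\<close> are rational,
  so is \<open>x ^ (n mod k)\<close>, and minimality of \<open>k\<close> forces the remainder to be
  0.\<close>

lemma least_rational_power_dvd:
  fixes x :: real
  assumes "x \<noteq> 0" "m > 0" "x ^ m \<in> \<rat>"
  obtains k where "k > 0" "x ^ k \<in> \<rat>" "\<And>n. x ^ n \<in> \<rat> \<Longrightarrow> k dvd n"
proof
  define k where "k = (LEAST k. k > 0 \<and> x ^ k \<in> \<rat>)"
  have k: "k > 0 \<and> x ^ k \<in> \<rat>"
    unfolding k_def by (rule LeastI[of _ m]) (use assms in simp)
  show "k > 0" "x ^ k \<in> \<rat>" using k by auto
  fix n assume n: "x ^ n \<in> \<rat>"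
  have "x ^ n = (x ^ k) ^ (n div k) * x ^ (n mod k)"
    by (simp flip: power_mult power_add)
  then have "x ^ (n mod k) = x ^ n / (x ^ k) ^ (n div k)"
    using \<open>x \<noteq> 0\<close> by (simp add: field_simps)
  also have "\<dots> \<in> \<rat>" by (rule Rats_divide[OF n Rats_power[OF conjunct2[OF k]]])
  finally have "\<not> n mod k > 0"
    using not_less_Least[of "n mod k" "\<lambda>k. k > 0 \<and> x ^ k \<in> \<rat>", folded k_def] k by simp
  then show "k dvd n" by (simp add: dvd_eq_mod_eq_0)
qed

theorem proposition5p3:
  fixes d :: nat
  assumes "d \<ge> 1"
    and "algebraic (kappa d)"
    and "exact_set d \<noteq> {}"
  shows "Gcd (exact_set d) > 1 \<and> (\<exists>p::nat. prime p \<and> (\<forall>n\<in>exact_set d. p dvd n))"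
proof -
  obtain N where N: "N \<in> exact_set d" using assms by blast
  have exact: "n \<ge> 1" "kappa d ^ (n ^ d) = real (indep_count d n)" if "n \<in> exact_set d" for n
    using that by (auto simp: exact_set_def)
  have pos: "kappa d > 0" and lt2: "kappa d < 2" using kappa_bounds[OF assms(1)] by auto
  have rat: "kappa d ^ (n ^ d) \<in> \<rat>" if "n \<in> exact_set d" for n
    using exact(2)[OF that] by simp
  have Npos: "N ^ d > 0" using exact(1)[OF N] by simp
  obtain k where k: "k > 0" "kappa d ^ k \<in> \<rat>" "\<And>n. kappa d ^ n \<in> \<rat> \<Longrightarrow> k dvd n"
    using least_rational_power_dvd[of "kappa d" "N ^ d"] pos Npos rat[OF N] by auto
  have "k \<noteq> 1"
  proof
    assume "k = 1"
    then have "kappa d \<in> \<rat>" using k by simp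
    \<comment> \<open>As a root of a natural number, \<open>kappa d\<close> is an algebraic integer,
      and a rational algebraic integer is an integer.\<close>
    moreover have "kappa d = root (N ^ d) (real (indep_count d N))"
      using exact(2)[OF N] pos Npos by (metis less_imp_le real_root_power_cancel)
    then have "algebraic_int (kappa d)" by auto
    ultimately have "kappa d \<in> \<int>" by (rule rational_algebraic_int_is_int[rotated])
    then obtain z where z: "kappa d = of_int z" by (elim Ints_cases)
    \<comment> \<open>1 is the only integer strictly between 0 and 2; it would make the count at
      \<open>N\<close> equal to 1.\<close>
    then have "kappa d = 1" using pos lt2 by auto
    then show False using exact[OF N] indep_count_ge_2[of N d] by auto
  qed
  then obtain p where p: "prime p" "p dvd k" using prime_factor_nat by blast
  \<comment> \<open>\<open>k\<close> divides only \<open>n ^ d\<close>; passing to a prime factor of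
    \<open>k\<close> gives a divisor of \<open>n\<close> itself.\<close>
  have dvd: "p dvd n" if "n \<in> exact_set d" for n
    using p k(3)[OF rat[OF that]] prime_dvd_power dvd_trans by metis
  then have "p dvd Gcd (exact_set d)" by (intro Gcd_greatest)
  \<comment> \<open>A \<open>Gcd\<close> of 0 would also be divisible by \<open>p\<close>; the
    positive element \<open>N\<close> excludes it.\<close>
  moreover have "Gcd (exact_set d) \<noteq> 0"
    using N exact(1)[OF N] by (auto simp: Gcd_0_iff)
  ultimately have "Gcd (exact_set d) > 1"
    using prime_gt_1_nat[OF p(1)] dvd_imp_le[of p "Gcd (exact_set d)"] by linarith
  then show ?thesis using p(1) dvd by blast
qed

end
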